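(* Let $k$ be a commutative ring, $\mathcal{A}$ an associative $k$-algebra, $M$ an $\mathcal{A}$-bimodule, and $\pi:M\to\mathcal{A}$ a generalized Rota-Baxter operator. Then $M$ becomes a dendriform algebra by the multiplications $m\succ n:=\pi(m)\cdot n$ and $m\prec n:=m\cdot\pi(n)$.
   Context: Algebras are not necessarily unital. A $k$-linear map $\pi:M\to\mathcal{A}$ is a generalized Rota-Baxter operator if $\pi(m)\pi(n)=\pi(\pi(m)\cdot n+m\cdot\pi(n))$ for all $m,n\in M$. A dendriform algebra is a $k$-module $E$ with two bilinear operations $\prec,\succ$ such that for all $x,y,z\in E$: $(x\prec y)\prec z=x\prec(y\succ z+y\prec z)$; $(x\succ y)\prec z=x\succ(y\prec z)$; $x\succ(y\succ z)=(x\succ y+x\prec y)\succ z$. *)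

theory Defs
  imports "HOL-Algebra.Module"
begin

definition linear_map ::
  "('k, 'r) ring_scheme \<Rightarrow> ('k, 'm, 'x) module_scheme \<Rightarrow> ('k, 'n, 'y) module_scheme
    \<Rightarrow> ('m \<Rightarrow> 'n) \<Rightarrow> bool"
  where "linear_map K M N f \<longleftrightarrow>
    f \<in> carrier M \<rightarrow> carrier N \<and>
    (\<forall>x\<in>carrier M. \<forall>y\<in>carrier M. f (x \<oplus>\<^bsub>M\<^esub> y) = f x \<oplus>\<^bsub>N\<^esub> f y) \<and>
    (\<forall>c\<in>carrier K. \<forall>x\<in>carrier M. f (c \<odot>\<^bsub>M\<^esub> x) = c \<odot>\<^bsub>N\<^esub> f x)"

definition bilinear_map ::
  "('k, 'r) ring_scheme \<Rightarrow> ('k, 'm, 'x) module_scheme \<Rightarrow> ('k, 'n, 'y) module_scheme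
    \<Rightarrow> ('k, 'p, 'z) module_scheme \<Rightarrow> ('m \<Rightarrow> 'n \<Rightarrow> 'p) \<Rightarrow> bool"
  where "bilinear_map K M N P f \<longleftrightarrow>
    (\<forall>x\<in>carrier M. linear_map K N P (\<lambda>y. f x y)) \<and>
    (\<forall>y\<in>carrier N. linear_map K M P (\<lambda>x. f x y))"

text \<open>
  Algebras need not be unital or commutative, so the locale \<^locale>\<open>algebra\<close> is too strong.
  The record field \<^const>\<open>one\<close> of \<open>A\<close> is unconstrained.
\<close>

locale assoc_algebra = module K A
  for K :: "('k, 'r) ring_scheme" (structure) and A :: "('k, 'a, 'x) module_scheme" (structure) +
  assumes mult_bilinear: "bilinear_map K A A A (\<otimes>\<^bsub>A\<^esub>)"
    and mult_assoc: "\<lbrakk> x \<in> carrier A; y \<in> carrier A; z \<in> carrier A \<rbrakk>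
      \<Longrightarrow> (x \<otimes>\<^bsub>A\<^esub> y) \<otimes>\<^bsub>A\<^esub> z = x \<otimes>\<^bsub>A\<^esub> (y \<otimes>\<^bsub>A\<^esub> z)"

text \<open>
  \<open>lact a m\<close> and \<open>ract m a\<close> are the left and right actions. Bilinearity over \<open>K\<close> makes
  both actions compatible with the one \<open>K\<close>-module structure of \<open>M\<close>.
  The fields \<^const>\<open>mult\<close> and \<^const>\<open>one\<close> of \<open>M\<close> and \<open>E\<close> below play no role.
\<close>

locale bimodule = assoc_algebra K A + M: module K M
  for K :: "('k, 'r) ring_scheme" (structure) and A :: "('k, 'a, 'x) module_scheme" (structure)
    and M :: "('k, 'm, 'y) module_scheme" (structure) +
  fixes lact :: "'a \<Rightarrow> 'm \<Rightarrow> 'm" and ract :: "'m \<Rightarrow> 'a \<Rightarrow> 'm"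
  assumes lact_bilinear: "bilinear_map K A M M lact"
    and ract_bilinear: "bilinear_map K M A M ract"
    and lact_lact: "\<lbrakk> a \<in> carrier A; b \<in> carrier A; m \<in> carrier M \<rbrakk>
      \<Longrightarrow> lact (a \<otimes>\<^bsub>A\<^esub> b) m = lact a (lact b m)"
    and ract_ract: "\<lbrakk> a \<in> carrier A; b \<in> carrier A; m \<in> carrier M \<rbrakk>
      \<Longrightarrow> ract m (a \<otimes>\<^bsub>A\<^esub> b) = ract (ract m a) b"
    and lact_ract: "\<lbrakk> a \<in> carrier A; b \<in> carrier A; m \<in> carrier M \<rbrakk>
      \<Longrightarrow> ract (lact a m) b = lact a (ract m b)"

definition generalized_rota_baxter ::
  "('k, 'r) ring_scheme \<Rightarrow> ('k, 'a, 'x) module_scheme \<Rightarrow> ('k, 'm, 'y) module_scheme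
    \<Rightarrow> ('a \<Rightarrow> 'm \<Rightarrow> 'm) \<Rightarrow> ('m \<Rightarrow> 'a \<Rightarrow> 'm) \<Rightarrow> ('m \<Rightarrow> 'a) \<Rightarrow> bool"
  where "generalized_rota_baxter K A M lact ract \<pi> \<longleftrightarrow>
    linear_map K M A \<pi> \<and>
    (\<forall>m\<in>carrier M. \<forall>n\<in>carrier M.
      \<pi> m \<otimes>\<^bsub>A\<^esub> \<pi> n = \<pi> (lact (\<pi> m) n \<oplus>\<^bsub>M\<^esub> ract m (\<pi> n)))"

locale dendriform_algebra = module K E
  for K :: "('k, 'r) ring_scheme" (structure) and E :: "('k, 'e, 'x) module_scheme" (structure) +
  fixes prec :: "'e \<Rightarrow> 'e \<Rightarrow> 'e" (infixl \<open>\<prec>\<close> 70)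
    and succ :: "'e \<Rightarrow> 'e \<Rightarrow> 'e" (infixl \<open>\<succ>\<close> 70)
  assumes prec_bilinear: "bilinear_map K E E E prec"
    and succ_bilinear: "bilinear_map K E E E succ"
    and prec_prec: "\<lbrakk> x \<in> carrier E; y \<in> carrier E; z \<in> carrier E \<rbrakk>
      \<Longrightarrow> (x \<prec> y) \<prec> z = x \<prec> ((y \<succ> z) \<oplus>\<^bsub>E\<^esub> (y \<prec> z))"
    and succ_prec: "\<lbrakk> x \<in> carrier E; y \<in> carrier E; z \<in> carrier E \<rbrakk>
      \<Longrightarrow> (x \<succ> y) \<prec> z = x \<succ> (y \<prec> z)"
    and succ_succ: "\<lbrakk> x \<in> carrier E; y \<in> carrier E; z \<in> carrier E \<rbrakk>
      \<Longrightarrow> x \<succ> (y \<succ> z) = ((x \<succ> y) \<oplus>\<^bsub>E\<^esub> (x \<prec> y)) \<succ> z"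

end

theory Submission
  imports Defs
begin

text \<open>The generalized Rota-Baxter identity says that \<open>\<pi>\<close> sends the sum of the
  two dendriform products of \<open>m\<close> and \<open>n\<close> to the product of
  \<open>\<pi> m\<close> and \<open>\<pi> n\<close> in \<open>A\<close>. So acting by the image of
  such a sum is acting twice, and the dendriform axioms become the three associativity laws of a
  bimodule. Bilinearity survives because \<open>\<pi>\<close> is linear and is substituted into one
  slot of a bilinear action.\<close>

lemma linear_map_compose:
  assumes "linear_map K M N f" and "linear_map K N P g"
  shows "linear_map K M P (\<lambda>x. g (f x))"
  using assms by (auto simp: linear_map_def Pi_iff)

lemma bilinear_map_compose_left:
  assumes "linear_map K L M f" and "bilinear_map K M N P b"
  shows "bilinear_map K L N P (\<lambda>x y. b (f x) y)"
proof -
  \<comment> \<open>Linearity of \<open>b (f x)\<close> in the other slot is only given for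
    \<open>f x\<close> in the carrier.\<close>
  have "f x \<in> carrier M" if "x \<in> carrier L" for x
    using assms(1) that by (auto simp: linear_map_def)
  then show ?thesis
    using assms(2) linear_map_compose[OF assms(1), of P "\<lambda>x. b x y" for x y]
    by (simp add: bilinear_map_def)
qed

lemma bilinear_map_compose_right:
  assumes "linear_map K L N f" and "bilinear_map K M N P b"
  shows "bilinear_map K M L P (\<lambda>x y. b x (f y))"
proof -
  have "f x \<in> carrier N" if "x \<in> carrier L" for x
    using assms(1) that by (auto simp: linear_map_def)
  then show ?thesis
    using assms(2) linear_map_compose[OF assms(1), of P "\<lambda>y. b x y" for x y]
    by (simp add: bilinear_map_def)
qed

theorem proposition2p10:
  fixes K :: "('k, 'r) ring_scheme"
    and A :: "('k, 'a, 'x) module_scheme"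
    and M :: "('k, 'm, 'y) module_scheme"
    and lact :: "'a \<Rightarrow> 'm \<Rightarrow> 'm" and ract :: "'m \<Rightarrow> 'a \<Rightarrow> 'm"
    and \<pi> :: "'m \<Rightarrow> 'a"
  assumes "cring K"
    and "assoc_algebra K A"
    and "bimodule K A M lact ract"
    and "generalized_rota_baxter K A M lact ract \<pi>"
  shows "dendriform_algebra K M
      (\<lambda>m n. ract m (\<pi> n))
      (\<lambda>m n. lact (\<pi> m) n)"
proof -
  interpret bimodule K A M lact ract by fact
  \<comment> \<open>\<open>rb\<close> reverses the defining equation, so that rewriting turns
    \<open>\<pi>\<close> of a sum into a product, which \<open>lact_lact\<close> and
    \<open>ract_ract\<close> then split.\<close>
  have \<pi>: "linear_map K M A \<pi>"
    and rb: "\<And>m n. m \<in> carrier M \<Longrightarrow> n \<in> carrier M \<Longrightarrow>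
      \<pi> (lact (\<pi> m) n \<oplus>\<^bsub>M\<^esub> ract m (\<pi> n)) = \<pi> m \<otimes>\<^bsub>A\<^esub> \<pi> n"
    using assms(4) by (auto simp: generalized_rota_baxter_def)
  have \<pi>_closed: "\<pi> m \<in> carrier A" if "m \<in> carrier M" for m
    using \<pi> that by (auto simp: linear_map_def)
  show ?thesis
  proof
    show "bilinear_map K M M M (\<lambda>m n. ract m (\<pi> n))"
      using \<pi> ract_bilinear by (rule bilinear_map_compose_right)
    show "bilinear_map K M M M (\<lambda>m n. lact (\<pi> m) n)"
      using \<pi> lact_bilinear by (rule bilinear_map_compose_left)
  \<comment> \<open>\<open>prec_prec\<close> comes from \<open>ract_ract\<close> with
    \<open>rb\<close>, \<open>succ_succ\<close> from \<open>lact_lact\<close> with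
    \<open>rb\<close>, and \<open>succ_prec\<close> from \<open>lact_ract\<close> alone.\<close>
  qed (simp_all add: \<pi>_closed rb lact_lact ract_ract lact_ract)
qed

end
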